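(* Assume the continuum hypothesis (CH). Then there is an atomless Boolean algebra $A$ such that $\mathrm{s}_{\mathrm{mm}}(A) = \mathfrak{f}(A) = \omega < \omega_1 = \mathfrak{u}(A)$.
   Context: Let $A$ be a Boolean algebra. A subset $Y\subseteq A$ is ideal-independent if for every $y\in Y$, $y$ does not belong to the ideal of $A$ generated by $Y\setminus\{y\}$. $\mathrm{s}_{\mathrm{mm}}(A)$ is the minimal size of an ideal-independent family of $A$ that is maximal with respect to inclusion. A free sequence in $A$ is a sequence $\{x_\alpha : \alpha<\gamma\}$ of elements of $A$ ($\gamma$ an ordinal) such that whenever $F$ and $G$ are finite subsets of $\gamma$ with $i<j$ for all $i\in F$ and $j\in G$, we have $\left(\prod_{\alpha\in F}x_\alpha\right)\cdot\left(\prod_{\beta\in G}-x_\beta\right)\neq 0$, where empty products equal $1$ by definition. $\mathfrak{f}(A)$ is the minimal size of a free sequence in $A$ that is maximal with respect to end-extension. $\mathfrak{u}(A)$ is the minimal size of a subset of $A$ that generates a nonprincipal ultrafilter of $A$.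
   Formalization: s_mm(A) is taken as the minimal size of an infinite maximal ideal-independent family; without "infinite", {1} is always a maximal ideal-independent family, so s_mm(A) would never be ω. *)

theory Defs
  imports Complex_Main
begin

unbundle cardinal_syntax

text \<open>
  The least cardinality of a member of \<open>\<F>\<close>, as a cardinal order. The minimum is attained as soon
  as \<open>\<F>\<close> is nonempty; for empty \<open>\<F>\<close> the value is the empty relation, i.e. the cardinal 0.
\<close>

definition min_card :: "'b set set \<Rightarrow> 'b rel" where
  "min_card \<F> =
     (if \<F> = {} then {}
      else (SOME r. r \<in> card_of ` \<F> \<and> (\<forall>r' \<in> card_of ` \<F>. r \<le>o r')))"

lemma min_card_attained:
  assumes "\<F> \<noteq> {}"
  shows "\<exists>Y \<in> \<F>. min_card \<F> = |Y| \<and> (\<forall>Z \<in> \<F>. |Y| \<le>o |Z| )"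
proof -
  let ?P = "\<lambda>r. r \<in> card_of ` \<F> \<and> (\<forall>r' \<in> card_of ` \<F>. r \<le>o r')"
  have "\<exists>r. ?P r"
    using exists_minim_Card_order[of "card_of ` \<F>"] assms by (auto intro: card_of_Card_order)
  then have "?P (SOME r. ?P r)" by (rule someI_ex)
  then show ?thesis
    using assms unfolding min_card_def by auto
qed

context boolean_algebra
begin

definition is_atom :: "'a \<Rightarrow> bool" where
  "is_atom a \<longleftrightarrow> a \<noteq> bot \<and> \<not> (\<exists>b. bot < b \<and> b < a)"

definition ba_ideal :: "'a set \<Rightarrow> bool" where
  "ba_ideal I \<longleftrightarrow>
     bot \<in> I \<and> (\<forall>x\<in>I. \<forall>y. y \<le> x \<longrightarrow> y \<in> I) \<and> (\<forall>x\<in>I. \<forall>y\<in>I. sup x y \<in> I)"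

definition ideal_independent :: "'a set \<Rightarrow> bool" where
  "ideal_independent Y \<longleftrightarrow> (\<forall>y\<in>Y. y \<notin> ba_ideal hull (Y - {y}))"

definition maximal_ideal_independent :: "'a set \<Rightarrow> bool" where
  "maximal_ideal_independent Y \<longleftrightarrow>
     ideal_independent Y \<and> (\<forall>Z. ideal_independent Z \<and> Y \<subseteq> Z \<longrightarrow> Z = Y)"

text \<open>
  The minimum defining \<open>s\<^sub>m\<^sub>m\<close> ranges over infinite families only, as is customary: in every
  nontrivial Boolean algebra the singleton \<open>{top}\<close> is a maximal ideal-independent family,
  so without this convention \<open>s\<^sub>m\<^sub>m\<close> would always be 1. In an atomless algebra, the infinite
  maximal families are exactly the maximal ones that generate a proper ideal.
\<close>

definition s_mm :: "'a rel" where
  "s_mm = min_card {Y. infinite Y \<and> maximal_ideal_independent Y}"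

text \<open>
  A sequence of length an ordinal \<open>\<gamma>\<close> is a function \<open>x\<close> on the field of a well-order \<open>r\<close> of
  type \<open>\<gamma>\<close>. The big operator of \<^locale>\<open>comm_monoid_set\<close> for \<^term>\<open>inf\<close> and \<^term>\<open>top\<close> is the
  finite product, with \<^term>\<open>top\<close> as the empty product.
\<close>

definition free_sequence :: "'i rel \<Rightarrow> ('i \<Rightarrow> 'a) \<Rightarrow> bool" where
  "free_sequence r x \<longleftrightarrow>
     Well_order r \<and>
     (\<forall>F G. finite F \<and> finite G \<and> F \<subseteq> Field r \<and> G \<subseteq> Field r \<and>
            (\<forall>i\<in>F. \<forall>j\<in>G. (i, j) \<in> r \<and> i \<noteq> j) \<longrightarrow>
        inf (comm_monoid_set.F inf top x F)
            (comm_monoid_set.F inf top (\<lambda>j. - x j) G) \<noteq> bot)"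

text \<open>
  \<^term>\<open>embedS r s f\<close> says that \<open>f\<close> identifies \<open>r\<close> with a proper initial segment of \<open>s\<close>.
\<close>

definition proper_end_extension ::
    "'i rel \<Rightarrow> ('i \<Rightarrow> 'a) \<Rightarrow> 'j rel \<Rightarrow> ('j \<Rightarrow> 'a) \<Rightarrow> bool" where
  "proper_end_extension r x s y \<longleftrightarrow>
     (\<exists>f. embedS r s f \<and> (\<forall>i\<in>Field r. y (f i) = x i))"

text \<open>
  Free sequences are injective (take \<open>F = {i}\<close> and \<open>G = {j}\<close>), so their index orders, and those of
  all their free end-extensions, embed into the algebra. Hence well-orders on subsets of the algebra
  itself represent the lengths of all free sequences.
\<close>

definition maximal_free_sequence :: "'a rel \<Rightarrow> ('a \<Rightarrow> 'a) \<Rightarrow> bool" where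
  "maximal_free_sequence r x \<longleftrightarrow>
     free_sequence r x \<and>
     \<not> (\<exists>(s :: 'a rel) y. free_sequence s y \<and> proper_end_extension r x s y)"

definition f_num :: "'a rel" where
  "f_num = min_card {Field r | r x. maximal_free_sequence r x}"

definition ba_filter :: "'a set \<Rightarrow> bool" where
  "ba_filter U \<longleftrightarrow>
     top \<in> U \<and> (\<forall>x\<in>U. \<forall>y. x \<le> y \<longrightarrow> y \<in> U) \<and> (\<forall>x\<in>U. \<forall>y\<in>U. inf x y \<in> U)"

definition ba_ultrafilter :: "'a set \<Rightarrow> bool" where
  "ba_ultrafilter U \<longleftrightarrow>
     ba_filter U \<and> bot \<notin> U \<and> (\<forall>V. ba_filter V \<and> bot \<notin> V \<and> U \<subseteq> V \<longrightarrow> V = U)"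

definition principal :: "'a set \<Rightarrow> bool" where
  "principal U \<longleftrightarrow> (\<exists>a. U = {y. a \<le> y})"

definition u_num :: "'a rel" where
  "u_num =
     min_card {X. ba_ultrafilter (ba_filter hull X) \<and> \<not> principal (ba_filter hull X)}"

end

end

theory Submission
  imports Defs "HOL-Library.Countable_Set"
begin

text \<open>
  The algebra consists of the sets \<open>a \<subseteq> nat \<times> nat\<close> all but finitely many of whose columns are empty
  or full, modulo finite sets. Let \<open>c n\<close> be the class of \<open>{n..} \<times> nat\<close>. Every element either misses some
  \<open>c n\<close> or lies above some gap \<open>c n - c (n + 1)\<close>. This single dichotomy says that the gaps form a
  maximal ideal-independent family and also that \<open>c 1, c 2, \<dots>\<close> is a maximal free sequence.

  On the other hand, countably many infinite subsets of \<open>nat\<close> can be split by one set. Applied to the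
  sets of full columns, or to the traces on single columns, this shows that every decreasing sequence
  of nonzero elements is split by one element. Hence the algebra is atomless, no ultrafilter has a
  countable base, and \<open>u\<close> is squeezed between \<open>\<omega>\<^sub>1\<close> and the size of the continuum. Since the algebra
  has exactly continuum many elements, it can be carried by \<open>nat set\<close>.
\<close>

section \<open>Extending well-orders, and minima equal to \<open>natLeq\<close>\<close>

text \<open>This serves to lengthen a finite free sequence by one term. Since \<open>t\<close> is
  placed above all old indices, the sets below old indices do not change, and the identity is a
  strict embedding because it misses \<open>t\<close>.\<close>

lemma Well_order_add_top:
  assumes r: "Well_order r" and t: "t \<notin> Field r"
  shows "Well_order (r \<union> insert t (Field r) \<times> {t})" (is "Well_order ?s")
    and "Field (r \<union> insert t (Field r) \<times> {t}) = insert t (Field r)"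
    and "embedS r (r \<union> insert t (Field r) \<times> {t}) id"
proof -
  have F: "(a, b) \<in> r \<Longrightarrow> a \<in> Field r \<and> b \<in> Field r" for a b
    by (auto simp: Field_def)
  show Fs: "Field ?s = insert t (Field r)"
    by (auto simp: Field_def)
  have lin: "Linear_order r" and wf: "wf (r - Id)"
    using r by (auto simp: well_order_on_def)
  have "wf ((r - Id) \<union> Field r \<times> {t})"
  proof (rule wf_Un[OF wf])
    show "wf (Field r \<times> {t})"
      by (rule wf_subset[OF wf_measure[of "\<lambda>y. if y = t then 1 else 0"]]) (use t in auto)
  qed (use t F in auto)
  moreover have "?s - Id = (r - Id) \<union> Field r \<times> {t}"
    using t by auto
  ultimately have "wf (?s - Id)" by simp
  moreover have "Linear_order ?s"
  proof -
    have "Refl r" "trans r" "antisym r" "Total r"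
      using lin by (auto simp: order_on_defs)
    moreover have "Refl ?s"
      using \<open>Refl r\<close> unfolding Fs by (auto simp: refl_on_def)
    moreover have "trans ?s"
      using \<open>trans r\<close> t F by (auto simp: trans_def)
    moreover have "antisym ?s"
      using \<open>antisym r\<close> t F by (auto simp: antisym_def)
    moreover have "?s \<subseteq> Field ?s \<times> Field ?s"
      by (auto simp: Field_def)
    moreover have "Total ?s"
      using \<open>Total r\<close> unfolding Fs by (auto simp: total_on_def)
    ultimately show ?thesis
      unfolding order_on_defs by blast
  qed
  ultimately show "Well_order ?s"
    by (simp add: well_order_on_def)
  show "embedS r ?s id"
    unfolding embedS_def embed_def
  proof safe
    fix a assume "a \<in> Field r"
    then have "under ?s a = under r a"
      using t by (auto simp: under_def)
    then show "bij_betw id (under r a) (under ?s (id a))" by simp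
  next
    assume "bij_betw id (Field r) (Field ?s)"
    then show False
      using t unfolding Fs by (auto simp: bij_betw_def)
  qed
qed

text \<open>This yields the index of an additional term in a proper end-extension. The image of
  \<open>f\<close> is an initial segment omitting some \<open>t\<close>; an image point above
  \<open>t\<close> would pull \<open>t\<close> into the segment, so by totality \<open>t\<close>
  lies above all of it.\<close>

lemma embedS_strict_upper_bound:
  assumes r: "Well_order r" and s: "Well_order s" and f: "embedS r s f"
  obtains t where "t \<in> Field s" "\<And>i. i \<in> Field r \<Longrightarrow> (f i, t) \<in> s \<and> f i \<noteq> t"
proof -
  interpret s: wo_rel s using s by (simp add: wo_rel_def)
  have e: "embed r s f" using f by (simp add: embedS_def)
  have of: "s.ofilter (f ` Field r)"
    by (rule embed_Field_ofilter[OF r s e])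
  obtain t where t: "t \<in> Field s" "t \<notin> f ` Field r"
    using embedS_iff[OF r e, of] f by auto
  have "(f i, t) \<in> s \<and> f i \<noteq> t" if i: "i \<in> Field r" for i
  proof -
    have "f i \<in> Field s" using of i by (auto simp: s.ofilter_def)
    moreover have "(t, f i) \<notin> s"
      using of i t by (auto simp: s.ofilter_def under_def)
    moreover have "f i \<noteq> t" using i t by auto
    ultimately show ?thesis
      using t(1) s.TOTAL by (auto simp: total_on_def)
  qed
  with t show ?thesis using that by blast
qed

lemma min_card_eq_natLeq:
  assumes "\<And>Y. Y \<in> \<F> \<Longrightarrow> infinite Y" and "Z \<in> \<F>" "countable Z"
  shows "min_card \<F> =o natLeq"
proof -
  obtain Y where Y: "Y \<in> \<F>" "min_card \<F> = |Y|" "|Y| \<le>o |Z|"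
    using min_card_attained[of \<F>] assms(2) by blast
  obtain g :: "_ \<Rightarrow> nat" where "inj_on g Z" using assms(3) by (auto simp: countable_def)
  then have "|Z| \<le>o |UNIV :: nat set|"
    using card_of_ordLeqI by blast
  then have "|Y| \<le>o natLeq"
    using Y(3) card_of_nat ordLeq_transitive ordLeq_ordIso_trans by blast
  moreover have "natLeq \<le>o |Y|"
    using assms(1)[OF Y(1)] infinite_iff_natLeq_ordLeq by blast
  ultimately show ?thesis
    using Y(2) by (simp add: ordIso_iff_ordLeq)
qed

section \<open>Towers and splitting in an arbitrary Boolean algebra\<close>

context boolean_algebra
begin

text \<open>Since \<open>c 0\<close> is \<open>top\<close>, the complement of \<open>c n\<close> is
  the join of the first \<open>n\<close> gaps. The last clause thus says that an element outside the
  ideal generated by the gaps lies above some gap.\<close>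

definition tower :: "(nat \<Rightarrow> 'a) \<Rightarrow> bool" where
  "tower c \<longleftrightarrow> c 0 = top \<and> (\<forall>n. c (Suc n) < c n) \<and>
     (\<forall>z. (\<exists>n. inf z (c n) = bot) \<or> (\<exists>n. inf (c n) (- c (Suc n)) \<le> z))"

text \<open>For constant sequences this gives atomlessness; for a decreasing base of a proper filter
  it shows that the filter is not maximal.\<close>

definition splittable :: "(nat \<Rightarrow> 'a) \<Rightarrow> bool" where
  "splittable w \<longleftrightarrow>
     ((\<forall>n. w n \<noteq> bot \<and> w (Suc n) \<le> w n) \<longrightarrow>
        (\<exists>z. \<forall>n. inf (w n) z \<noteq> bot \<and> inf (w n) (- z) \<noteq> bot))"

lemma le_iff_inf_compl_bot: "a \<le> b \<longleftrightarrow> inf a (- b) = bot"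
proof
  assume "inf a (- b) = bot"
  then have "a \<le> - (- b)" using inf_shunt by blast
  then show "a \<le> b" by simp
next
  assume "a \<le> b"
  then have "inf a (- b) \<le> inf b (- b)" by (rule inf_mono) simp
  then show "inf a (- b) = bot" by (simp add: bot_unique)
qed

lemma le_bigmeet_iff:
  assumes "finite F"
  shows "z \<le> comm_monoid_set.F inf top x F \<longleftrightarrow> (\<forall>i\<in>F. z \<le> x i)"
proof -
  interpret P: comm_monoid_set inf top
    by unfold_locales (auto simp: ac_simps)
  show ?thesis using assms by induction auto
qed

text \<open>Splitting the constant sequence at \<open>a\<close> leaves a nonzero piece strictly
  below \<open>a\<close>.\<close>

lemma splittable_not_atom:
  assumes "\<forall>w. splittable w"
  shows "\<not> is_atom a"
proof
  assume a: "is_atom a"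
  then have "a \<noteq> bot" by (simp add: is_atom_def)
  then obtain z where z: "inf a z \<noteq> bot" "inf a (- z) \<noteq> bot"
    using assms[unfolded splittable_def, rule_format, of "\<lambda>_. a"] by auto
  have "inf a z \<noteq> a"
    using z(2) by (metis inf_le2 le_iff_inf_compl_bot)
  then have "bot < inf a z \<and> inf a z < a"
    using z(1) by (simp add: bot_less less_le)
  then show False using a by (auto simp: is_atom_def)
qed

section \<open>Generated ideals and filters, and the value of \<open>u_num\<close>\<close>

lemma ba_ideal_hull: "ba_ideal (ba_ideal hull Y)"
  by (rule hull_in) (unfold ba_ideal_def, blast)

lemma ba_filter_hull: "ba_filter (ba_filter hull Y)"
  by (rule hull_in) (unfold ba_filter_def, blast)

lemma ba_filter_decreasing_base:
  assumes "\<And>n. w (Suc n) \<le> w n"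
  shows "ba_filter {y. \<exists>n::nat. w n \<le> y}"
proof -
  have "w (max m n) \<le> w m" "w (max m n) \<le> w n" for m n
    using lift_Suc_antimono_le[of w] assms by auto
  then have "w (max m n) \<le> inf x y" if "w m \<le> x" "w n \<le> y" for m n x y
    using that by (meson le_inf_iff order_trans)
  then show ?thesis
    unfolding ba_filter_def using top_greatest order_trans by blast
qed

text \<open>The finite meets of an enumeration of \<open>X\<close> form a decreasing base
  \<open>w\<close> of the generated filter. If that filter is proper, an element \<open>z\<close>
  splitting every \<open>w n\<close> can be adjoined without losing properness, yet it is not in the
  filter.\<close>

lemma countable_not_ultrafilter_base:
  assumes split: "\<forall>w. splittable w" and X: "countable X"
  shows "\<not> ba_ultrafilter (ba_filter hull X)"
proof
  let ?U = "ba_filter hull X"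
  assume U: "ba_ultrafilter ?U"
  have F: "ba_filter ?U" and nb: "bot \<notin> ?U" using U by (auto simp: ba_ultrafilter_def)
  \<comment> \<open>Inserting \<open>top\<close> makes the set nonempty, so that it is the range of
    a sequence; every filter contains \<open>top\<close> anyway.\<close>
  define u where "u = from_nat_into (insert top X)"
  have ru: "range u = insert top X"
    unfolding u_def by (rule range_from_nat_into) (use X in auto)
  define w where "w = rec_nat (u 0) (\<lambda>n a. inf a (u (Suc n)))"
  have w0: "w 0 = u 0" and wS: "w (Suc n) = inf (w n) (u (Suc n))" for n
    by (auto simp: w_def)
  have uU: "u n \<in> ?U" for n
    using ru F hull_subset[of X ba_filter] by (metis ba_filter_def insertE rangeI subsetD)
  have infU: "inf a b \<in> ?U" if "a \<in> ?U" "b \<in> ?U" for a b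
    using F that unfolding ba_filter_def by blast
  have wU: "w n \<in> ?U" for n
    by (induction n) (use uU infU in \<open>auto simp: w0 wS\<close>)
  have dec: "w (Suc n) \<le> w n" for n by (simp add: wS)
  have wu: "w n \<le> u n" for n by (cases n) (auto simp: w0 wS)
  have base: "?U \<subseteq> {y. \<exists>n. w n \<le> y}"
  proof (rule hull_minimal)
    show "X \<subseteq> {y. \<exists>n. w n \<le> y}" using ru wu by (metis (mono_tags, lifting) insertCI mem_Collect_eq rangeE subsetI)
  qed (rule ba_filter_decreasing_base[of w, OF dec])
  have "w n \<noteq> bot" for n using wU nb by metis
  then obtain z where z: "inf (w n) z \<noteq> bot" "inf (w n) (- z) \<noteq> bot" for n
    using split dec unfolding splittable_def by meson
  \<comment> \<open>\<open>?V\<close> is the filter obtained by adjoining \<open>z\<close>.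
    Maximality would put \<open>z\<close> above some \<open>w n\<close>, against
    \<open>z(2)\<close>.\<close>
  let ?V = "{y. \<exists>n. inf (w n) z \<le> y}"
  have "ba_filter ?V"
    by (rule ba_filter_decreasing_base) (use dec in \<open>auto intro: le_infI1\<close>)
  moreover have "bot \<notin> ?V" using z(1) by (auto simp: bot_unique)
  moreover have "?U \<subseteq> ?V" using base by (auto intro: le_infI1)
  ultimately have "?V = ?U" using U unfolding ba_ultrafilter_def by blast
  moreover have "z \<in> ?V" by auto
  ultimately obtain n where "w n \<le> z" using base by blast
  then show False using z(2) le_iff_inf_compl_bot by blast
qed

text \<open>An ultrafilter generates itself, so once principality is excluded, its existence makes
  the family defining \<open>u_num\<close> nonempty; the minimum over an empty family would be
  0.\<close>

lemma ex_ba_ultrafilter: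
  assumes "bot \<noteq> top"
  shows "\<exists>U. ba_ultrafilter U"
proof -
  let ?A = "{V. ba_filter V \<and> bot \<notin> V}"
  have "\<exists>M\<in>?A. \<forall>X\<in>?A. M \<subseteq> X \<longrightarrow> X = M"
  proof (rule subset_Zorn_nonempty)
    have "{top} \<in> ?A" using assms by (auto simp: ba_filter_def top_unique)
    then show "?A \<noteq> {}" by blast
  next
    fix C assume C: "C \<noteq> {}" "subset.chain ?A C"
    have flt: "ba_filter V" "bot \<notin> V" if "V \<in> C" for V
      using C(2) that by (auto simp: subset_chain_def)
    have "inf x y \<in> \<Union>C" if "x \<in> V" "y \<in> W" "V \<in> C" "W \<in> C" for x y V W
    proof -
      have "V \<subseteq> W \<or> W \<subseteq> V" using C(2) that by (auto simp: subset_chain_def)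
      then show ?thesis using that flt[OF that(3)] flt[OF that(4)] unfolding ba_filter_def by blast
    qed
    moreover have "top \<in> \<Union>C" using C(1) flt unfolding ba_filter_def by blast
    moreover have "y \<in> \<Union>C" if "x \<in> V" "V \<in> C" "x \<le> y" for x y V
      using that flt unfolding ba_filter_def by blast
    ultimately have "ba_filter (\<Union>C)" unfolding ba_filter_def by blast
    then show "\<Union>C \<in> ?A" using flt by auto
  qed
  then show ?thesis unfolding ba_ultrafilter_def by blast
qed

text \<open>No countable set generates an ultrafilter, which gives the lower bound; every generating
  set is a subset of the algebra, which gives the upper bound.\<close>

lemma u_num_eq_cardSuc_natLeq:
  assumes split: "\<forall>w. splittable w" and ne: "bot \<noteq> top"
    and small: "|UNIV :: 'a set| \<le>o cardSuc natLeq"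
  shows "cardSuc natLeq =o u_num"
proof -
  let ?\<F> = "{X. ba_ultrafilter (ba_filter hull X) \<and> \<not> principal (ba_filter hull X)}"
  obtain U where U: "ba_ultrafilter U" using ex_ba_ultrafilter[OF ne] by blast
  then have hU: "ba_filter hull U = U"
    by (intro hull_same) (simp add: ba_ultrafilter_def)
  \<comment> \<open>A principal ultrafilter would be generated by one element, hence by a countable
    set.\<close>
  have "\<not> principal U"
  proof
    assume "principal U"
    then obtain a where a: "U = {y. a \<le> y}" by (auto simp: principal_def)
    have "ba_filter hull {a} = U"
    proof (rule hull_unique)
      show "{a} \<subseteq> U" "ba_filter U" using a U by (auto simp: ba_ultrafilter_def)
      show "U \<subseteq> V" if "{a} \<subseteq> V" "ba_filter V" for V
        using that unfolding a ba_filter_def by auto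
    qed
    then show False using countable_not_ultrafilter_base[OF split, of "{a}"] U by simp
  qed
  with U hU have "U \<in> ?\<F>" by simp
  then obtain Y where Y: "Y \<in> ?\<F>" "u_num = |Y|"
    using min_card_attained[of ?\<F>] unfolding u_num_def by blast
  have "\<not> countable Y" using Y(1) countable_not_ultrafilter_base[OF split] by blast
  then have "\<not> |Y| \<le>o natLeq"
    using card_of_nat ordIso_symmetric ordLeq_ordIso_trans card_of_ordLeq[of Y "UNIV :: nat set"]
    by (metis countableI)
  then have "natLeq <o |Y|"
    using not_ordLeq_iff_ordLess[OF natLeq_Well_order card_of_Well_order] by blast
  then have "cardSuc natLeq \<le>o |Y|"
    by (rule cardSuc_least[OF natLeq_Card_order card_of_Card_order])
  moreover have "|Y| \<le>o cardSuc natLeq"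
    using card_of_mono1[OF subset_UNIV] small ordLeq_transitive by blast
  ultimately show ?thesis unfolding Y(2) by (simp add: ordIso_iff_ordLeq)
qed

section \<open>Finite free sequences are not maximal\<close>

text \<open>The product \<open>a\<close> of all terms of a finite free sequence is nonzero. Cutting
  \<open>a\<close> into two nonzero parts and appending one of them keeps the sequence free.\<close>

lemma maximal_free_sequence_infinite:
  assumes split: "\<forall>w. splittable w" and inf: "infinite (UNIV :: 'a set)"
    and max: "maximal_free_sequence r x"
  shows "infinite (Field r)"
proof
  assume fin: "finite (Field r)"
  let ?P = "comm_monoid_set.F inf top"
  have free: "free_sequence r x" using max by (simp add: maximal_free_sequence_def)
  then have r: "Well_order r" by (simp add: free_sequence_def)
  obtain t where t: "t \<notin> Field r" using fin inf ex_new_if_finite by blast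
  define a where "a = ?P x (Field r)"
  have ax: "a \<le> x i" if "i \<in> Field r" for i
    using le_bigmeet_iff[OF fin, of a x] that by (simp add: a_def)
  have "inf a (?P (\<lambda>j. - x j) {}) \<noteq> bot"
    using free fin unfolding free_sequence_def a_def by blast
  then have a0: "a \<noteq> bot" by auto
  then obtain y where y0: "inf a y \<noteq> bot" and y1: "inf a (- y) \<noteq> bot"
    using split[unfolded splittable_def, rule_format, of "\<lambda>_. a"] by auto
  let ?s = "r \<union> insert t (Field r) \<times> {t}"
  let ?x = "x(t := inf a y)"
  have "free_sequence ?s ?x"
    unfolding free_sequence_def
  proof (intro conjI allI impI)
    show "Well_order ?s" by (rule Well_order_add_top(1)[OF r t])
  next
    fix F G
    assume H: "finite F \<and> finite G \<and> F \<subseteq> Field ?s \<and> G \<subseteq> Field ?s \<and>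
            (\<forall>i\<in>F. \<forall>j\<in>G. (i, j) \<in> ?s \<and> i \<noteq> j)"
    then have F: "F \<subseteq> insert t (Field r)" "finite F" and G: "G \<subseteq> insert t (Field r)" "finite G"
      using Well_order_add_top(2)[OF r t] by auto
    have top: "(t, j) \<in> ?s \<Longrightarrow> j = t" for j using t by (auto simp: Field_def)
    \<comment> \<open>A product is nonzero as soon as a nonzero \<open>b\<close> lies below all of
      its factors; each case below exhibits such a \<open>b\<close>.\<close>
    have nz: "inf (?P ?x F) (?P (\<lambda>j. - ?x j) G) \<noteq> bot"
      if "b \<noteq> bot" "\<And>i. i \<in> F \<Longrightarrow> b \<le> ?x i" "\<And>j. j \<in> G \<Longrightarrow> b \<le> - ?x j" for b
    proof -
      have "b \<le> inf (?P ?x F) (?P (\<lambda>j. - ?x j) G)"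
        using that F(2) G(2) by (simp add: le_bigmeet_iff)
      then show ?thesis using that(1) by (metis bot_unique)
    qed
    show "inf (?P ?x F) (?P (\<lambda>j. - ?x j) G) \<noteq> bot"
    proof (cases "t \<in> F")
      case True
      \<comment> \<open>\<open>t\<close> is the last index, so no member of \<open>G\<close> can
        come after it.\<close>
      then have "G = {}" using H top by blast
      then show ?thesis
        using y0 F t ax by (intro nz[of "inf a y"]) (auto intro: le_infI1)
    next
      case tF: False
      show ?thesis
      proof (cases "G - {t} = {}")
        case True
        \<comment> \<open>Now \<open>G\<close> contains at most \<open>t\<close>, and the other part
          of \<open>a\<close> lies below the complement of the new term.\<close>
        then show ?thesis
          using y1 F tF ax by (intro nz[of "inf a (- y)"]) (auto intro: le_infI1 le_infI2)
      next
        case False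
        then obtain j where j: "j \<in> G" "j \<noteq> t" by blast
        \<comment> \<open>An old index \<open>j\<close> in \<open>G\<close> suffices:
          \<open>- x j\<close> is already below the complement of the new term, because
          \<open>a\<close> lies below \<open>x j\<close>. So the product over the old indices is the
          witness.\<close>
        let ?b = "inf (?P x F) (?P (\<lambda>j. - x j) (G - {t}))"
        have b: "?b \<noteq> bot"
        proof -
          have "F \<subseteq> Field r" "G - {t} \<subseteq> Field r" using F G tF by auto
          moreover have "\<forall>i\<in>F. \<forall>j\<in>G - {t}. (i, j) \<in> r \<and> i \<noteq> j" using H by auto
          ultimately show ?thesis using free F(2) G(2) unfolding free_sequence_def by blast
        qed
        have bF: "?b \<le> x i" if "i \<in> F" for i
          using le_bigmeet_iff[OF F(2), of ?b x] that by auto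
        have bG: "?b \<le> - x i" if "i \<in> G - {t}" for i
          using le_bigmeet_iff[of "G - {t}" ?b "\<lambda>j. - x j"] G(2) that by auto
        have "a \<le> x j" using ax[of j] j G by blast
        then have "- x j \<le> - inf a y" by (simp add: le_supI1)
        then have "?b \<le> - inf a y" using bG[of j] j by (meson Diff_iff empty_iff insert_iff order_trans)
        then show ?thesis
          using b bF bG tF by (intro nz[of ?b]) auto
      qed
    qed
  qed
  moreover have "proper_end_extension r x ?s ?x"
    using Well_order_add_top(3)[OF r t] t unfolding proper_end_extension_def
    by (intro exI[of _ id]) auto
  ultimately show False using max unfolding maximal_free_sequence_def by blast
qed

section \<open>The gaps of a tower, and the values of \<open>s_mm\<close> and
  \<open>f_num\<close>\<close>

lemma tower_antimono:
  assumes "tower c" "m \<le> n"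
  shows "c n \<le> c m"
  using lift_Suc_antimono_le[of c] assms by (auto simp: tower_def less_le)

lemma tower_gap_ne_bot:
  assumes "tower c"
  shows "inf (c n) (- c (Suc n)) \<noteq> bot"
  using assms le_iff_inf_compl_bot[of "c n" "c (Suc n)"] by (auto simp: tower_def less_le_not_le)

lemma tower_gap_disjoint:
  assumes c: "tower c" and "m \<noteq> n"
  shows "inf (inf (c m) (- c (Suc m))) (inf (c n) (- c (Suc n))) = bot"
proof -
  have *: "inf (inf (c m) (- c (Suc m))) (inf (c n) (- c (Suc n))) = bot" if "m < n" for m n
  proof -
    have "inf (c n) (- c (Suc m)) = bot"
      using tower_antimono[OF c, of "Suc m" n] that le_iff_inf_compl_bot by auto
    moreover have "inf (inf (c m) (- c (Suc m))) (inf (c n) (- c (Suc n))) \<le> inf (c n) (- c (Suc m))"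
      by (simp add: le_infI1 le_infI2)
    ultimately show ?thesis by (simp add: bot_unique)
  qed
  show ?thesis using *[of m n] *[of n m] assms(2) by (cases "m < n") (auto simp: inf.commute)
qed

lemma tower_gap_inj:
  assumes "tower c"
  shows "inj (\<lambda>n. inf (c n) (- c (Suc n)))"
proof (rule injI, rule ccontr)
  fix m n assume eq: "inf (c m) (- c (Suc m)) = inf (c n) (- c (Suc n))" and "m \<noteq> n"
  then show False using tower_gap_disjoint[OF assms \<open>m \<noteq> n\<close>] tower_gap_ne_bot[OF assms, of n] by simp
qed

text \<open>Independence holds because the gaps are nonzero and pairwise disjoint. A further element
  \<open>z\<close> lies in the ideal generated by the gaps or above some gap; in the first case
  \<open>z\<close> is redundant, in the second that gap is.\<close>

lemma maximal_ideal_independent_tower_gaps: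
  assumes c: "tower c"
  shows "maximal_ideal_independent (range (\<lambda>n. inf (c n) (- c (Suc n))))"
proof -
  define d where "d n = inf (c n) (- c (Suc n))" for n
  have d0: "d n \<noteq> bot" for n using tower_gap_ne_bot[OF c] by (simp add: d_def)
  have dd: "inf (d m) (d n) = bot" if "m \<noteq> n" for m n
    using tower_gap_disjoint[OF c that] by (simp add: d_def)
  have "ideal_independent (range d)"
    unfolding ideal_independent_def
  proof safe
    fix k assume "d k \<in> ba_ideal hull (range d - {d k})"
    \<comment> \<open>The elements disjoint from \<open>d k\<close> form an ideal containing all
      other gaps.\<close>
    moreover have "ba_ideal hull (range d - {d k}) \<subseteq> {y. inf y (d k) = bot}"
    proof (rule hull_minimal)
      show "range d - {d k} \<subseteq> {y. inf y (d k) = bot}" using dd by (auto, metis)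
      show "ba_ideal {y. inf y (d k) = bot}"
        unfolding ba_ideal_def
        by (auto simp: inf_sup_distrib2) (metis bot_unique inf_mono order_refl)
    qed
    ultimately have "inf (d k) (d k) = bot" by blast
    then show False using d0[of k] by simp
  qed
  moreover have "Z = range d" if Z: "ideal_independent Z" "range d \<subseteq> Z" for Z
  proof (rule ccontr)
    assume "Z \<noteq> range d"
    then obtain z where z: "z \<in> Z" "z \<notin> range d" using Z(2) by blast
    let ?I = "ba_ideal hull (Z - {z})"
    have I: "ba_ideal ?I" by (rule ba_ideal_hull)
    have dI: "d n \<in> ?I" for n
      using Z(2) z(2) by (intro hull_inc) auto
    \<comment> \<open>The complement of \<open>c n\<close> is the join of the first \<open>n\<close>
      gaps; the induction starts from \<open>c 0 = top\<close>.\<close>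
    have cI: "- c n \<in> ?I" for n
    proof (induction n)
      case 0
      have "- c 0 = bot" using c by (simp add: tower_def)
      moreover have "bot \<in> ?I" using I unfolding ba_ideal_def by blast
      ultimately show ?case by simp
    next
      case (Suc n)
      have "- c (Suc n) \<le> sup (- c n) (d n)"
        by (simp add: d_def sup_inf_distrib1)
      moreover have "sup (- c n) (d n) \<in> ?I" using Suc dI I unfolding ba_ideal_def by blast
      ultimately show ?case using I unfolding ba_ideal_def by blast
    qed
    consider n where "inf z (c n) = bot" | n where "d n \<le> z"
      using c unfolding tower_def d_def by blast
    then show False
    proof cases
      case 1
      then have "z \<le> - c n" using inf_shunt by blast
      then have "z \<in> ?I" using cI I unfolding ba_ideal_def by blast
      then show False using Z(1) z(1) unfolding ideal_independent_def by blast
    next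
      case 2
      \<comment> \<open>\<open>z\<close> is not a gap, so it survives the removal of
        \<open>d n\<close>.\<close>
      have "z \<in> Z - {d n}" using z by auto
      then have "z \<in> ba_ideal hull (Z - {d n})" by (rule hull_inc)
      then have "d n \<in> ba_ideal hull (Z - {d n})"
        using 2 ba_ideal_hull[of "Z - {d n}"] unfolding ba_ideal_def by blast
      then show False using Z unfolding ideal_independent_def by blast
    qed
  qed
  ultimately show ?thesis
    unfolding maximal_ideal_independent_def d_def by blast
qed

lemma s_mm_eq_natLeq:
  assumes "tower c"
  shows "s_mm =o natLeq"
  unfolding s_mm_def
proof (rule min_card_eq_natLeq)
  show "range (\<lambda>n. inf (c n) (- c (Suc n))) \<in> {Y. infinite Y \<and> maximal_ideal_independent Y}"
    using maximal_ideal_independent_tower_gaps[OF assms] tower_gap_inj[OF assms]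
    by (simp add: range_inj_infinite)
qed auto

text \<open>The sequence starts at \<open>c 1\<close>, since the complement of
  \<open>c 0 = top\<close> is \<open>bot\<close> and would destroy freeness. Index orders of maximal
  free sequences live on the algebra, so the gap \<open>d n\<close> serves as the index of
  \<open>c (Suc n)\<close>.\<close>

lemma maximal_free_sequence_tower:
  assumes c: "tower c"
  defines "d \<equiv> \<lambda>n. inf (c n) (- c (Suc n))"
  shows "maximal_free_sequence (dir_image natLeq d) (\<lambda>a. c (Suc (inv d a)))"
proof -
  let ?r = "dir_image natLeq d" and ?x = "\<lambda>a. c (Suc (inv d a))"
  let ?P = "comm_monoid_set.F inf top"
  have inj: "inj d" unfolding d_def by (rule tower_gap_inj[OF c])
  have Fr: "Field ?r = range d" by (simp add: dir_image_Field Field_natLeq)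
  have r: "Well_order ?r"
    by (rule Well_order_dir_image[OF natLeq_Well_order]) (use inj in \<open>simp add: Field_natLeq\<close>)
  have rd: "(d m, d n) \<in> ?r \<longleftrightarrow> m \<le> n" for m n
    using inj by (auto simp: dir_image_def natLeq_def inj_eq)
  have xd: "?x (d n) = c (Suc n)" for n using inj by simp
  have "free_sequence ?r ?x"
    unfolding free_sequence_def
  proof (intro conjI allI impI r)
    fix F G
    assume H: "finite F \<and> finite G \<and> F \<subseteq> Field ?r \<and> G \<subseteq> Field ?r \<and>
            (\<forall>i\<in>F. \<forall>j\<in>G. (i, j) \<in> ?r \<and> i \<noteq> j)"
    obtain F' where F': "F = d ` F'" "finite F'"
      using H Fr by (metis finite_subset_image)
    obtain G' where G': "G = d ` G'" "finite G'"
      using H Fr by (metis finite_subset_image)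
    have lt: "i < j" if "i \<in> F'" "j \<in> G'" for i j
      using H that unfolding F' G' by (metis imageI le_neq_implies_less rd)
    \<comment> \<open>\<open>k\<close> separates the two index sets. The gap \<open>d k\<close> lies
      below \<open>c (Suc i)\<close> for \<open>i < k\<close> and below the complement of
      \<open>c (Suc j)\<close> for \<open>k \<le> j\<close>, so it witnesses that the product is
      nonzero.\<close>
    obtain k where k: "\<And>i. i \<in> F' \<Longrightarrow> i < k" "\<And>j. j \<in> G' \<Longrightarrow> k \<le> j"
    proof (cases "G' = {}")
      case True
      then show ?thesis using F'(2) that finite_nat_set_iff_bounded by (metis empty_iff)
    next
      case False
      then show ?thesis using G'(2) lt that[of "Min G'"] by auto
    qed
    have "d k \<le> c (Suc i)" if "i \<in> F'" for i
      using tower_antimono[OF c, of "Suc i" k] k(1)[OF that] by (auto simp: d_def intro: le_infI1)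
    moreover have "d k \<le> - c (Suc j)" if "j \<in> G'" for j
      using tower_antimono[OF c, of "Suc k" "Suc j"] k(2)[OF that] by (auto simp: d_def intro: le_infI2)
    ultimately have "d k \<le> inf (?P ?x F) (?P (\<lambda>j. - ?x j) G)"
      using H by (simp add: le_bigmeet_iff F'(1) G'(1) inj)
    moreover have "d k \<noteq> bot" unfolding d_def by (rule tower_gap_ne_bot[OF c])
    ultimately show "inf (?P ?x F) (?P (\<lambda>j. - ?x j) G) \<noteq> bot" by (metis bot_unique)
  qed
  moreover have False if s: "free_sequence s y" and ext: "proper_end_extension ?r ?x s y"
    for s :: "'a rel" and y
  proof -
    have ws: "Well_order s" using s by (simp add: free_sequence_def)
    obtain f where f: "embedS ?r s f" and yf: "\<And>i. i \<in> Field ?r \<Longrightarrow> y (f i) = ?x i"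
      using ext by (auto simp: proper_end_extension_def)
    have ef: "embed ?r s f" using f by (simp add: embedS_def)
    obtain t where t: "t \<in> Field s" "\<And>i. i \<in> Field ?r \<Longrightarrow> (f i, t) \<in> s \<and> f i \<noteq> t"
      using embedS_strict_upper_bound[OF r ws f] by blast
    \<comment> \<open>\<open>e n\<close> is the position of \<open>c (Suc n)\<close> in the
      extension, and \<open>t\<close> that of an extra term after all of them.\<close>
    define e where "e n = f (d n)" for n
    have ye: "y (e n) = c (Suc n)" for n
      using yf[of "d n"] xd Fr by (simp add: e_def)
    have es: "(e n, t) \<in> s" "e n \<noteq> t" "e n \<in> Field s" for n
      using t(2)[of "d n"] FieldI1[of "f (d n)" t s] unfolding Fr e_def by auto
    have "compat ?r s f" "inj_on f (Field ?r)"
      by (rule embed_compat[OF ef], rule embed_inj_on[OF r ef])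
    then have ee: "(e m, e n) \<in> s \<and> e m \<noteq> e n" if "m < n" for m n
    proof -
      have "d m \<noteq> d n" using inj that by (simp add: inj_eq)
      moreover have "(d m, d n) \<in> ?r" using rd[of m n] that by simp
      ultimately show ?thesis
        using \<open>compat ?r s f\<close> \<open>inj_on f (Field ?r)\<close> Fr
        unfolding compat_def e_def inj_on_def by blast
    qed
    have fr: "inf (?P y F) (?P (\<lambda>j. - y j) G) \<noteq> bot"
      if "finite F" "finite G" "F \<subseteq> Field s" "G \<subseteq> Field s"
        "\<And>i j. i \<in> F \<Longrightarrow> j \<in> G \<Longrightarrow> (i, j) \<in> s \<and> i \<noteq> j" for F G
      using s[unfolded free_sequence_def, THEN conjunct2, rule_format, of F G] that by simp
    consider n where "inf (y t) (c n) = bot" | n where "d n \<le> y t"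
      using c unfolding tower_def d_def by blast
    then show False
    proof cases
      case 1
      \<comment> \<open>With \<open>e n\<close> and \<open>t\<close> in \<open>F\<close>, the
        product lies below both \<open>y t\<close> and \<open>c n\<close>.\<close>
      let ?b = "inf (?P y {e n, t}) (?P (\<lambda>j. - y j) {})"
      have "?b \<le> y t" "?b \<le> c (Suc n)"
        using le_bigmeet_iff[of "{e n, t}" ?b y] by (auto simp: ye)
      moreover have "c (Suc n) \<le> c n" by (rule tower_antimono[OF c]) simp
      ultimately have "?b \<le> inf (y t) (c n)" by (blast intro: le_infI order_trans)
      moreover have "?b \<noteq> bot" by (rule fr) (use es t in auto)
      ultimately show False using 1 by (simp add: bot_unique)
    next
      case 2
      \<comment> \<open>The product is to be pressed below the gap \<open>d n\<close>, hence below
        \<open>y t\<close>, while \<open>t\<close> in \<open>G\<close> puts it below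
        \<open>- y t\<close>. The bound \<open>c n\<close> is the term at \<open>e m\<close> when
        \<open>n = Suc m\<close>; for \<open>n = 0\<close> it is \<open>top\<close>, which is not a
        term, and \<open>F\<close> is empty.\<close>
      define F where "F = (case n of 0 \<Rightarrow> {} | Suc m \<Rightarrow> {e m})"
      let ?b = "inf (?P y F) (?P (\<lambda>j. - y j) {e n, t})"
      have fin: "finite F" by (auto simp: F_def split: nat.split)
      have "?b \<le> - y t" "?b \<le> - c (Suc n)"
        using le_bigmeet_iff[of "{e n, t}" ?b "\<lambda>j. - y j"] by (auto simp: ye)
      moreover have "?b \<le> c n"
      proof (cases n)
        case 0
        then show ?thesis using c by (simp add: tower_def)
      next
        case (Suc m)
        then show ?thesis using le_bigmeet_iff[OF fin, of ?b y] by (auto simp: ye F_def)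
      qed
      ultimately have "?b \<le> d n" by (simp add: d_def)
      then have "?b \<le> y t" using 2 by (rule order_trans)
      then have "?b \<le> inf (y t) (- y t)" using \<open>?b \<le> - y t\<close> by (rule le_infI)
      moreover have "?b \<noteq> bot"
        by (rule fr) (use es t ee in \<open>auto simp: F_def split: nat.splits\<close>)
      ultimately show False by (simp add: bot_unique)
    qed
  qed
  ultimately show ?thesis unfolding maximal_free_sequence_def by blast
qed

lemma f_num_eq_natLeq:
  assumes split: "\<forall>w. splittable w" and c: "tower c"
  shows "f_num =o natLeq"
  unfolding f_num_def
proof (rule min_card_eq_natLeq)
  have "infinite (range (\<lambda>n. inf (c n) (- c (Suc n))))"
    using tower_gap_inj[OF c] by (rule range_inj_infinite)
  then have "infinite (UNIV :: 'a set)" using finite_subset subset_UNIV by blast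
  then show "infinite Y" if "Y \<in> {Field r |r x. maximal_free_sequence r x}" for Y
    using maximal_free_sequence_infinite[OF split] that by blast
  show "range (\<lambda>n. inf (c n) (- c (Suc n))) \<in> {Field r |r x. maximal_free_sequence r x}"
    using maximal_free_sequence_tower[OF c]
    by (auto simp: dir_image_Field Field_natLeq intro!: exI)
qed auto

end

section \<open>Splitting countably many infinite sets of natural numbers\<close>

lemma strict_mono_selection:
  fixes T :: "nat \<Rightarrow> nat set"
  assumes "\<And>n. infinite (T n)"
  obtains e where "strict_mono e" "\<And>n. e n \<in> T n"
proof -
  have "\<exists>e. \<forall>n. e n \<in> T n \<and> e n < e (Suc n)"
  proof (rule dependent_nat_choice)
    show "\<exists>x. x \<in> T 0" using assms[of 0] by (metis ex_in_conv finite.emptyI)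
    show "\<exists>y. y \<in> T (Suc n) \<and> x < y" for x n
      using assms[of "Suc n"] by (meson infinite_nat_iff_unbounded)
  qed
  then show ?thesis using that by (auto simp: strict_mono_Suc_iff)
qed

text \<open>The sets are listed with infinite repetition and a strictly increasing sequence of
  members is selected. Those at even positions form \<open>Z\<close>, those at odd positions stay
  outside, and every set occurs infinitely often at both parities.\<close>

lemma countable_infinite_sets_split:
  fixes \<S> :: "nat set set"
  assumes "countable \<S>" and inf: "\<And>S. S \<in> \<S> \<Longrightarrow> infinite S"
  obtains Z where "\<And>S. S \<in> \<S> \<Longrightarrow> infinite (S \<inter> Z)" "\<And>S. S \<in> \<S> \<Longrightarrow> infinite (S - Z)"
proof (cases "\<S> = {}")
  case True
  then show ?thesis using that by auto
next
  case False
  define S where "S = from_nat_into \<S>"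
  have rS: "range S = \<S>"
    unfolding S_def by (rule range_from_nat_into) fact+
  \<comment> \<open>Positions \<open>2 * m\<close> and \<open>2 * m + 1\<close> carry the same set,
    and by the pairing function each set is attached to infinitely many \<open>m\<close>.\<close>
  define T where "T n = S (fst (prod_decode (n div 2)))" for n
  have "infinite (T n)" for n using inf rS by (auto simp: T_def)
  then obtain e where e: "strict_mono e" "\<And>n. e n \<in> T n"
    using strict_mono_selection by blast
  then have inj: "inj e" by (simp add: strict_mono_imp_inj_on)
  define Z where "Z = e ` {n. even n}"
  have "infinite (S i \<inter> Z) \<and> infinite (S i - Z)" for i
  proof -
    let ?a = "\<lambda>m. e (2 * prod_encode (i, m))" and ?b = "\<lambda>m. e (2 * prod_encode (i, m) + 1)"
    have "inj ?a" "inj ?b" by (auto intro!: injI dest: injD[OF inj])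
    moreover have "?a m \<in> S i \<inter> Z" "?b m \<in> S i - Z" for m
      using e(2)[of "2 * prod_encode (i, m)"] e(2)[of "2 * prod_encode (i, m) + 1"] inj
      by (auto simp: T_def Z_def inj_eq)
    ultimately show ?thesis
      by (meson image_subsetI infinite_super range_inj_infinite)
  qed
  then show ?thesis using that[of Z] rS by auto
qed

section \<open>Fields of sets modulo finite sets\<close>

text \<open>The carrier is an arbitrary type and \<open>p\<close> a transversal of the classes
  modulo finite sets, so that the quotient can later be placed on \<open>nat set\<close>. Operations
  act on representatives and return through \<open>q\<close> to the point of the resulting
  class.\<close>

locale field_mod_finite =
  fixes \<A> :: "'b set set" and p :: "'a \<Rightarrow> 'b set"
  assumes empty_in: "{} \<in> \<A>"
    and Compl_in: "a \<in> \<A> \<Longrightarrow> - a \<in> \<A>"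
    and Int_in: "a \<in> \<A> \<Longrightarrow> b \<in> \<A> \<Longrightarrow> a \<inter> b \<in> \<A>"
    and p_in: "p x \<in> \<A>"
    and p_unique: "finite (p x - p y) \<Longrightarrow> finite (p y - p x) \<Longrightarrow> x = y"
    and p_exhaust: "a \<in> \<A> \<Longrightarrow> \<exists>x. finite (p x - a) \<and> finite (a - p x)"
begin

definition q :: "'b set \<Rightarrow> 'a" where
  "q a = (SOME x. finite (p x - a) \<and> finite (a - p x))"

lemma pq:
  assumes "a \<in> \<A>"
  shows "finite (p (q a) - a)" "finite (a - p (q a))"
  using someI_ex[OF p_exhaust[OF assms]] by (auto simp: q_def)

definition le (infix "\<preceq>" 50) where "x \<preceq> y \<longleftrightarrow> finite (p x - p y)"
definition meet where "meet x y = q (p x \<inter> p y)"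
definition join where "join x y = q (p x \<union> p y)"
definition compl where "compl x = q (- p x)"

lemma Un_in: "a \<in> \<A> \<Longrightarrow> b \<in> \<A> \<Longrightarrow> a \<union> b \<in> \<A>"
  using Compl_in[of "- a \<inter> - b"] Int_in[of "- a" "- b"] Compl_in by simp

lemma p_meet: "finite (p (meet x y) - p x \<inter> p y)" "finite (p x \<inter> p y - p (meet x y))"
  unfolding meet_def using pq[OF Int_in[OF p_in p_in]] by auto

lemma p_join: "finite (p (join x y) - (p x \<union> p y))" "finite (p x \<union> p y - p (join x y))"
  unfolding join_def using pq[OF Un_in[OF p_in p_in]] by auto

lemma p_compl: "finite (p (compl x) - - p x)" "finite (- p x - p (compl x))"
  unfolding compl_def using pq[OF Compl_in[OF p_in]] by auto

lemma p_bot: "finite (p (q {}))"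
  using pq[OF empty_in] by simp

lemma p_top: "finite (- p (q UNIV))"
  using pq[OF Compl_in[OF empty_in]] by (simp add: Compl_eq_Diff_UNIV)

text \<open>The laws hold for sets, and passing to representatives causes only finite errors. Each
  law thus reduces to enclosing a difference of representatives in a finite union of such
  errors.\<close>

lemma boolean_algebra:
  "class.boolean_algebra (\<lambda>x y. meet x (compl y)) compl meet (\<preceq>)
     (\<lambda>x y. x \<preceq> y \<and> \<not> y \<preceq> x) join (q {}) (q UNIV)"
proof unfold_locales
  fix x y z
  show "x \<preceq> x" by (simp add: le_def)
  show "x \<preceq> z" if "x \<preceq> y" "y \<preceq> z"
  proof -
    have "p x - p z \<subseteq> (p x - p y) \<union> (p y - p z)" by blast
    then show ?thesis using that finite_subset unfolding le_def by blast
  qed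
  show "x = y" if "x \<preceq> y" "y \<preceq> x" using that p_unique by (simp add: le_def)
  show "meet x y \<preceq> x"
    unfolding le_def by (rule finite_subset[OF _ p_meet(1)[of x y]]) blast
  show "meet x y \<preceq> y"
    unfolding le_def by (rule finite_subset[OF _ p_meet(1)[of x y]]) blast
  show "x \<preceq> meet y z" if "x \<preceq> y" "x \<preceq> z"
  proof -
    have "p x - p (meet y z) \<subseteq> (p x - p y) \<union> (p x - p z) \<union> (p y \<inter> p z - p (meet y z))" by blast
    then show ?thesis using that p_meet finite_subset unfolding le_def by blast
  qed
  show "x \<preceq> join x y"
    unfolding le_def by (rule finite_subset[OF _ p_join(2)[of x y]]) blast
  show "y \<preceq> join x y"
    unfolding le_def by (rule finite_subset[OF _ p_join(2)[of x y]]) blast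
  show "join y z \<preceq> x" if "y \<preceq> x" "z \<preceq> x"
  proof -
    have "p (join y z) - p x \<subseteq> (p y - p x) \<union> (p z - p x) \<union> (p (join y z) - (p y \<union> p z))" by blast
    then show ?thesis using that p_join finite_subset unfolding le_def by blast
  qed
  show "q {} \<preceq> x" using p_bot by (simp add: le_def)
  show "x \<preceq> q UNIV" unfolding le_def by (rule finite_subset[OF _ p_top]) blast
  show "join x (meet y z) = meet (join x y) (join x z)"
  proof (rule p_unique)
    \<comment> \<open>These are the errors, in both directions, of the five operations in the
      distributive law.\<close>
    let ?E = "(p (meet y z) - p y \<inter> p z) \<union> (p y \<inter> p z - p (meet y z))
      \<union> (p (join x (meet y z)) - (p x \<union> p (meet y z))) \<union> (p x \<union> p (meet y z) - p (join x (meet y z)))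
      \<union> (p (join x y) - (p x \<union> p y)) \<union> (p x \<union> p y - p (join x y))
      \<union> (p (join x z) - (p x \<union> p z)) \<union> (p x \<union> p z - p (join x z))
      \<union> (p (meet (join x y) (join x z)) - p (join x y) \<inter> p (join x z))
      \<union> (p (join x y) \<inter> p (join x z) - p (meet (join x y) (join x z)))"
    have fin: "finite ?E" using p_meet p_join by blast
    show "finite (p (join x (meet y z)) - p (meet (join x y) (join x z)))"
      by (rule finite_subset[OF _ fin]) blast
    show "finite (p (meet (join x y) (join x z)) - p (join x (meet y z)))"
      by (rule finite_subset[OF _ fin]) blast
  qed
  show "meet x (compl x) = q {}"
  proof (rule p_unique)
    have "p (meet x (compl x)) - p (q {}) \<subseteq>
        (p (meet x (compl x)) - p x \<inter> p (compl x)) \<union> (p (compl x) - - p x)" by blast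
    then show "finite (p (meet x (compl x)) - p (q {}))"
      using p_meet p_compl finite_subset by blast
  qed (use p_bot in simp)
  show "join x (compl x) = q UNIV"
  proof (rule p_unique)
    have "p (q UNIV) - p (join x (compl x)) \<subseteq>
        (p x \<union> p (compl x) - p (join x (compl x))) \<union> (- p x - p (compl x))" by blast
    then show "finite (p (q UNIV) - p (join x (compl x)))"
      using p_join p_compl finite_subset by blast
    show "finite (p (join x (compl x)) - p (q UNIV))"
      by (rule finite_subset[OF _ p_top]) blast
  qed
qed auto

lemma eq_bot_iff: "x = q {} \<longleftrightarrow> finite (p x)"
  using p_unique[of x "q {}"] p_bot by auto

lemma meet_eq_bot_iff: "meet x y = q {} \<longleftrightarrow> finite (p x \<inter> p y)"
proof -
  have "p (meet x y) \<subseteq> (p (meet x y) - p x \<inter> p y) \<union> (p x \<inter> p y)"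
    "p x \<inter> p y \<subseteq> (p x \<inter> p y - p (meet x y)) \<union> p (meet x y)" by blast+
  then show ?thesis
    unfolding eq_bot_iff using p_meet[of x y] by (meson finite_UnI finite_subset)
qed

lemma meet_compl_eq_bot_iff: "meet x (compl y) = q {} \<longleftrightarrow> finite (p x - p y)"
proof -
  have "p x - p y \<subseteq> (p x \<inter> p (compl y)) \<union> (- p y - p (compl y))"
    "p x \<inter> p (compl y) \<subseteq> (p x - p y) \<union> (p (compl y) - - p y)" by blast+
  then show ?thesis
    unfolding meet_eq_bot_iff using p_compl[of y] by (meson finite_UnI finite_subset)
qed

end

section \<open>Sets with almost all columns empty or full\<close>

definition trivial_columns :: "(nat \<times> nat) set set" where
  "trivial_columns = {a. finite {k. a `` {k} \<noteq> {} \<and> a `` {k} \<noteq> UNIV}}"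

lemma trivial_columns_Compl:
  assumes "a \<in> trivial_columns"
  shows "- a \<in> trivial_columns"
proof -
  have "(- a) `` {k} = - (a `` {k})" for k by auto
  then have "{k. (- a) `` {k} \<noteq> {} \<and> (- a) `` {k} \<noteq> UNIV} = {k. a `` {k} \<noteq> {} \<and> a `` {k} \<noteq> UNIV}"
    by auto
  then show ?thesis using assms by (simp add: trivial_columns_def)
qed

lemma trivial_columns_Int:
  assumes "a \<in> trivial_columns" "b \<in> trivial_columns"
  shows "a \<inter> b \<in> trivial_columns"
proof -
  have "(a \<inter> b) `` {k} = a `` {k} \<inter> b `` {k}" for k by auto
  then have "{k. (a \<inter> b) `` {k} \<noteq> {} \<and> (a \<inter> b) `` {k} \<noteq> UNIV} \<subseteq>
      {k. a `` {k} \<noteq> {} \<and> a `` {k} \<noteq> UNIV} \<union> {k. b `` {k} \<noteq> {} \<and> b `` {k} \<noteq> UNIV}"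
    by auto
  then show ?thesis
    using assms finite_subset unfolding trivial_columns_def by blast
qed

text \<open>The two alternatives provide the two kinds of splitting elements: one set repeated in
  finitely many columns, and unions of full columns.\<close>

lemma Times_in_trivial_columns:
  assumes "finite K \<or> Z = UNIV"
  shows "K \<times> Z \<in> trivial_columns"
proof -
  have "(K \<times> Z) `` {k} = (if k \<in> K then Z else {})" for k by auto
  then have "{k. (K \<times> Z) `` {k} \<noteq> {} \<and> (K \<times> Z) `` {k} \<noteq> UNIV} \<subseteq> (if Z = UNIV then {} else K)"
    by (auto split: if_splits)
  then show ?thesis
    unfolding trivial_columns_def mem_Collect_eq by (rule finite_subset) (use assms in auto)
qed

text \<open>There are exactly continuum many classes: subsets of \<open>nat\<close> inject into them
  as unions of full columns, and a class injects into \<open>nat set\<close> by encoding a chosen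
  representative. The resulting bijection \<open>h\<close> followed by a choice of representatives
  is \<open>p\<close>.\<close>

lemma ex_trivial_columns_transversal:
  "\<exists>p :: nat set \<Rightarrow> (nat \<times> nat) set. field_mod_finite trivial_columns p"
proof -
  define R where "R = {(a, b). a \<in> trivial_columns \<and> b \<in> trivial_columns \<and> finite (a - b) \<and> finite (b - a)}"
  have "trans R"
  proof (rule transI)
    fix a b c assume ab: "(a, b) \<in> R" and bc: "(b, c) \<in> R"
    have "a - c \<subseteq> (a - b) \<union> (b - c)" "c - a \<subseteq> (c - b) \<union> (b - a)" by blast+
    moreover have "finite ((a - b) \<union> (b - c))" "finite ((c - b) \<union> (b - a))"
      using ab bc by (auto simp: R_def)
    ultimately show "(a, c) \<in> R"
      using ab bc finite_subset by (auto simp: R_def)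
  qed
  then have R: "equiv trivial_columns R"
    by (auto simp: equiv_def refl_on_def sym_def R_def)
  let ?Q = "trivial_columns // R"
  let ?f = "\<lambda>Z :: nat set. R `` {Z \<times> UNIV}" and ?g = "\<lambda>Q. prod_encode ` (SOME a. a \<in> Q)"
  have Zin: "Z \<times> UNIV \<in> trivial_columns" for Z :: "nat set" by (simp add: Times_in_trivial_columns)
  have some: "(SOME a. a \<in> Q) \<in> Q" if "Q \<in> ?Q" for Q
    using in_quotient_imp_non_empty[OF R that] by (simp add: some_in_eq)
  have "inj ?f"
  proof (rule injI)
    fix Y Z assume "?f Y = ?f Z"
    then have "(Y \<times> (UNIV :: nat set), Z \<times> UNIV) \<in> R"
      using eq_equiv_class[OF _ R Zin] by blast
    \<comment> \<open>Distinct \<open>Y\<close> and \<open>Z\<close> would differ by at least one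
      whole infinite column.\<close>
    then have "finite ((Y - Z) \<times> (UNIV :: nat set))" "finite ((Z - Y) \<times> (UNIV :: nat set))"
      by (auto simp: R_def Times_Diff_distrib1)
    then have "Y - Z = {}" "Z - Y = {}"
      using finite_cartesian_productD2 infinite_UNIV_nat by blast+
    then show "Y = Z" by blast
  qed
  moreover have "range ?f \<subseteq> ?Q" using Zin by (auto intro: quotientI)
  moreover have "inj_on ?g ?Q"
  proof (rule inj_onI)
    fix P Q assume PQ: "P \<in> ?Q" "Q \<in> ?Q" and "?g P = ?g Q"
    then have "(SOME a. a \<in> P) = (SOME a. a \<in> Q)"
      by (simp add: inj_image_eq_iff inj_prod_encode)
    then have "P \<inter> Q \<noteq> {}" using some[OF PQ(1)] some[OF PQ(2)] by auto
    then show "P = Q" using quotient_disj[OF R PQ] by blast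
  qed
  ultimately obtain h where h: "bij_betw h (UNIV :: nat set set) ?Q"
    using Schroeder_Bernstein[of ?f UNIV ?Q ?g] by auto
  then have hQ: "h x \<in> ?Q" for x by (auto simp: bij_betw_def)
  define p where "p x = (SOME a. a \<in> h x)" for x
  have ph: "p x \<in> h x" for x unfolding p_def by (rule some[OF hQ])
  have hR: "h x = R `` {p x}" for x
  proof -
    obtain a where a: "h x = R `` {a}" using hQ[of x] by (auto elim: quotientE)
    then have "(a, p x) \<in> R" using ph[of x] by simp
    then show ?thesis unfolding a by (rule equiv_class_eq[OF R])
  qed
  show ?thesis
  proof (intro exI[of _ p], unfold_locales)
    show "{} \<in> trivial_columns" by (simp add: trivial_columns_def)
    show px: "p x \<in> trivial_columns" for x
      using ph hQ in_quotient_imp_subset[OF R] by blast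
    show "x = y" if "finite (p x - p y)" "finite (p y - p x)" for x y
    proof -
      have "(p x, p y) \<in> R" using that px by (simp add: R_def)
      then have "h x = h y" unfolding hR by (rule equiv_class_eq[OF R])
      then show ?thesis using h by (auto simp: bij_betw_def inj_eq)
    qed
    show "\<exists>x. finite (p x - a) \<and> finite (a - p x)" if "a \<in> trivial_columns" for a
    proof -
      have "R `` {a} \<in> ?Q" using that by (rule quotientI)
      then obtain x where "h x = R `` {a}" using h by (metis bij_betw_def imageE)
      then have "(a, p x) \<in> R" using ph[of x] by simp
      then show ?thesis by (auto simp: R_def)
    qed
  qed (auto intro: trivial_columns_Compl trivial_columns_Int)
qed

section \<open>The tower and the splitting elements in the quotient\<close>

locale trivial_columns_mod_finite = field_mod_finite trivial_columns p for p :: "'a \<Rightarrow> (nat \<times> nat) set"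
begin

interpretation ba: boolean_algebra "\<lambda>x y. meet x (compl y)" compl meet "(\<preceq>)"
  "\<lambda>x y. x \<preceq> y \<and> \<not> y \<preceq> x" join "q {}" "q UNIV"
  by (rule boolean_algebra)

text \<open>A set with a full column contains the corresponding gap. Without full columns, all
  nonempty columns are exceptional, hence finitely many, and the set misses every column from some
  \<open>m\<close> on.\<close>

lemma tower: "ba.tower (\<lambda>n. q ({n..} \<times> UNIV))"
proof -
  define C where "C n = {n..} \<times> (UNIV :: nat set)" for n :: nat
  define c where "c n = q (C n)" for n
  have C: "finite (p (c n) - C n)" "finite (C n - p (c n))" for n
    unfolding c_def by (intro pq; simp add: C_def Times_in_trivial_columns)+
  have col: "C n - C (Suc n) = {n} \<times> UNIV" for n by (auto simp: C_def)
  have c0: "c 0 = q UNIV" by (simp add: c_def C_def)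
  have dec: "c (Suc n) \<preceq> c n" for n
  proof -
    have "p (c (Suc n)) - p (c n) \<subseteq> (p (c (Suc n)) - C (Suc n)) \<union> (C n - p (c n))"
      by (auto simp: C_def)
    then show ?thesis unfolding le_def using C by (meson finite_UnI finite_subset)
  qed
  have strict: "\<not> c n \<preceq> c (Suc n)" for n
  proof
    assume "c n \<preceq> c (Suc n)"
    then have "finite ((p (c n) - p (c (Suc n))) \<union> (C n - p (c n)) \<union> (p (c (Suc n)) - C (Suc n)))"
      using C by (simp add: le_def)
    moreover have "C n - C (Suc n) \<subseteq>
        (p (c n) - p (c (Suc n))) \<union> (C n - p (c n)) \<union> (p (c (Suc n)) - C (Suc n))" by blast
    ultimately have "finite ({n} \<times> (UNIV :: nat set))"
      unfolding col by (rule rev_finite_subset)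
    then have "finite (UNIV :: nat set)" by (rule finite_cartesian_productD2) simp
    then show False by simp
  qed
  have dich: "(\<exists>n. meet z (c n) = q {}) \<or> (\<exists>n. meet (c n) (compl (c (Suc n))) \<preceq> z)" for z
  proof (cases "\<exists>n. p z `` {n} = UNIV")
    case True
    then obtain n where n: "p z `` {n} = UNIV" by blast
    let ?b = "compl (c (Suc n))"
    have "p (meet (c n) ?b) - p z \<subseteq> (p (meet (c n) ?b) - p (c n) \<inter> p ?b) \<union>
        (p ?b - - p (c (Suc n))) \<union> (p (c n) - C n) \<union> (C (Suc n) - p (c (Suc n)))"
      (is "_ \<subseteq> ?E")
    proof -
      have "{n} \<times> UNIV \<subseteq> p z" using n by blast
      then have "C n \<subseteq> C (Suc n) \<union> p z" using col[of n] by blast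
      then show ?thesis by blast
    qed
    moreover have "finite ?E" using p_meet p_compl C by blast
    ultimately show ?thesis unfolding le_def using finite_subset by blast
  next
    case False
    then have "finite {k. p z `` {k} \<noteq> {}}"
      using p_in[of z] by (simp add: trivial_columns_def)
    then obtain m where "\<forall>k\<in>{k. p z `` {k} \<noteq> {}}. k < m"
      using finite_nat_set_iff_bounded by blast
    then have "p z \<inter> C m = {}" by (force simp: C_def)
    then have "p z \<inter> p (c m) \<subseteq> p (c m) - C m" by blast
    then show ?thesis unfolding meet_eq_bot_iff using C finite_subset by blast
  qed
  have "ba.tower c"
    unfolding ba.tower_def using c0 dec strict dich by simp
  then show ?thesis by (simp add: c_def[abs_def] C_def)
qed

text \<open>Either every \<open>w n\<close> has infinitely many full columns, and one set of columns
  splits all these families; or from some \<open>N\<close> on the sequence lives, up to finite sets,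
  in finitely many columns, and one subset of \<open>nat\<close> splits all infinite traces on
  columns.\<close>

lemma splittable: "ba.splittable w"
  unfolding ba.splittable_def
proof (intro impI)
  assume w: "\<forall>n. w n \<noteq> q {} \<and> w (Suc n) \<preceq> w n"
  have inf: "infinite (p (w n))" for n using w eq_bot_iff[of "w n"] by simp
  have dec: "finite (p (w n) - p (w m))" if "m \<le> n" for m n
    using ba.lift_Suc_antimono_le[of w m n] w that unfolding le_def by blast
  \<comment> \<open>Splitting a tail is enough: earlier members contain later ones up to finite
    sets.\<close>
  have "\<exists>s\<in>trivial_columns. \<exists>N. \<forall>n\<ge>N. infinite (p (w n) \<inter> s) \<and> infinite (p (w n) - s)"
  proof (cases "\<forall>n. infinite {k. p (w n) `` {k} = UNIV}")
    case True
    define full where "full n = {k. p (w n) `` {k} = UNIV}" for n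
    obtain Z where Z: "\<And>S. S \<in> range full \<Longrightarrow> infinite (S \<inter> Z)"
        "\<And>S. S \<in> range full \<Longrightarrow> infinite (S - Z)"
      by (rule countable_infinite_sets_split[of "range full"]) (use True in \<open>auto simp: full_def\<close>)
    have *: "infinite A" if "{k} \<times> UNIV \<subseteq> A" for k :: nat and A :: "(nat \<times> nat) set"
    proof
      assume "finite A"
      then have "finite ({k} \<times> (UNIV :: nat set))" using that by (rule rev_finite_subset)
      then have "finite (UNIV :: nat set)" by (rule finite_cartesian_productD2) simp
      then show False by simp
    qed
    have "infinite (p (w n) \<inter> Z \<times> UNIV)" "infinite (p (w n) - Z \<times> UNIV)" for n
    proof -
      have "full n \<inter> Z \<noteq> {}" "full n - Z \<noteq> {}"
        using Z[of "full n"] by (metis finite.emptyI rangeI)+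
      then obtain k l where "k \<in> full n \<inter> Z" "l \<in> full n - Z"
        by blast
      then have kl: "p (w n) `` {k} = UNIV" "k \<in> Z" "p (w n) `` {l} = UNIV" "l \<notin> Z"
        by (auto simp: full_def)
      then have "{k} \<times> UNIV \<subseteq> p (w n) \<inter> Z \<times> UNIV" "{l} \<times> UNIV \<subseteq> p (w n) - Z \<times> UNIV" by blast+
      then show "infinite (p (w n) \<inter> Z \<times> UNIV)" "infinite (p (w n) - Z \<times> UNIV)" using * by blast+
    qed
    then show ?thesis using Times_in_trivial_columns[of Z UNIV] by blast
  next
    case False
    then obtain N where N: "finite {k. p (w N) `` {k} = UNIV}" by blast
    \<comment> \<open>Only finitely many columns of \<open>w N\<close> are full and only finitely
      many are exceptional, so \<open>K\<close> is finite.\<close>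
    define K where "K = {k. p (w N) `` {k} \<noteq> {}}"
    have "K \<subseteq> {k. p (w N) `` {k} = UNIV} \<union> {k. p (w N) `` {k} \<noteq> {} \<and> p (w N) `` {k} \<noteq> UNIV}"
      by (auto simp: K_def)
    then have finK: "finite K"
      using N p_in[of "w N"] unfolding trivial_columns_def mem_Collect_eq by (meson finite_UnI finite_subset)
    \<comment> \<open>The column with an infinite trace may depend on \<open>n\<close>, so all
      infinite traces are split at once.\<close>
    define \<S> where "\<S> = {S \<in> (\<lambda>(n, k). p (w n) `` {k}) ` UNIV. infinite S}"
    have "countable \<S>" unfolding \<S>_def by (rule countable_subset[of _ "range (\<lambda>(n, k). p (w n) `` {k})"]) auto
    then obtain Z where Z: "\<And>S. S \<in> \<S> \<Longrightarrow> infinite (S \<inter> Z)" "\<And>S. S \<in> \<S> \<Longrightarrow> infinite (S - Z)"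
      by (rule countable_infinite_sets_split) (auto simp: \<S>_def)
    have "infinite (p (w n) \<inter> K \<times> Z) \<and> infinite (p (w n) - K \<times> Z)" if "N \<le> n" for n
    proof -
      \<comment> \<open>If all traces on the finitely many columns in \<open>K\<close> were finite,
        \<open>p (w n)\<close> would be finite, since it exceeds \<open>p (w N)\<close> only by a
        finite set.\<close>
      have "\<exists>k\<in>K. infinite (p (w n) `` {k})"
      proof (rule ccontr)
        assume "\<not> ?thesis"
        then have "finite (SIGMA k:K. p (w n) `` {k})" using finK by blast
        moreover have "p (w n) \<subseteq> (p (w n) - p (w N)) \<union> (SIGMA k:K. p (w n) `` {k})"
          by (auto simp: K_def)
        ultimately show False using inf dec[OF that] by (meson finite_UnI finite_subset)
      qed
      then obtain k where k: "k \<in> K" "infinite (p (w n) `` {k})" by blast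
      then have "p (w n) `` {k} \<in> \<S>" unfolding \<S>_def by force
      note Z[OF this]
      moreover have "Pair k ` (p (w n) `` {k} \<inter> Z) \<subseteq> p (w n) \<inter> K \<times> Z"
        "Pair k ` (p (w n) `` {k} - Z) \<subseteq> p (w n) - K \<times> Z" using k(1) by auto
      ultimately show ?thesis
        by (meson finite_imageD finite_subset inj_onI prod.inject)
    qed
    then show ?thesis using Times_in_trivial_columns[of K Z] finK by blast
  qed
  then obtain s N where s: "s \<in> trivial_columns"
    and N: "\<And>n. n \<ge> N \<Longrightarrow> infinite (p (w n) \<inter> s) \<and> infinite (p (w n) - s)" by blast
  \<comment> \<open>The conclusion passes from \<open>s\<close> to its representative and from the
    tail to all \<open>n\<close>, each time at the cost of a finite set.\<close>
  have "\<not> finite (p (w n) \<inter> p (q s))" "\<not> finite (p (w n) - p (q s))" for n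
  proof -
    let ?m = "max n N"
    have "p (w ?m) \<inter> s \<subseteq> (p (w n) \<inter> p (q s)) \<union> (p (w ?m) - p (w n)) \<union> (s - p (q s))"
      "p (w ?m) - s \<subseteq> (p (w n) - p (q s)) \<union> (p (w ?m) - p (w n)) \<union> (p (q s) - s)" by blast+
    then show "\<not> finite (p (w n) \<inter> p (q s))" "\<not> finite (p (w n) - p (q s))"
      using N[of ?m] dec[of n ?m] pq[OF s] by (meson finite_UnI finite_subset max.cobounded1 max.cobounded2)+
  qed
  then show "\<exists>z. \<forall>n. meet (w n) z \<noteq> q {} \<and> meet (w n) (compl z) \<noteq> q {}"
    using meet_eq_bot_iff[of _ "q s"] meet_compl_eq_bot_iff[of _ "q s"] by (intro exI[of _ "q s"]) metis
qed

end

section \<open>The algebra under the continuum hypothesis\<close>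

theorem corollary1p6:
  assumes CH: "ctwo ^c natLeq =o cardSuc natLeq"
  shows "\<exists>(minus :: nat set \<Rightarrow> nat set \<Rightarrow> nat set) uminus inf less_eq less sup bot top.
    class.boolean_algebra minus uminus inf less_eq less sup bot top \<and>
    (\<nexists>a. boolean_algebra.is_atom less bot a) \<and>
    boolean_algebra.s_mm less_eq sup bot =o boolean_algebra.f_num uminus inf bot top \<and>
    boolean_algebra.f_num uminus inf bot top =o natLeq \<and>
    natLeq <o cardSuc natLeq \<and>
    cardSuc natLeq =o boolean_algebra.u_num inf less_eq bot top"
proof -
  obtain p :: "nat set \<Rightarrow> (nat \<times> nat) set" where "field_mod_finite trivial_columns p"
    using ex_trivial_columns_transversal by blast
  then interpret trivial_columns_mod_finite p
    by (rule trivial_columns_mod_finite.intro)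
  interpret ba: boolean_algebra "\<lambda>x y. meet x (compl y)" compl meet le
    "\<lambda>x y. le x y \<and> \<not> le y x" join "q {}" "q UNIV"
    by (rule boolean_algebra)
  have split: "\<forall>w. ba.splittable w" using splittable by blast
  note c = tower
  \<comment> \<open>A one-element algebra has no room for the strict descent from
    \<open>c 0 = top\<close> to \<open>c 1\<close>.\<close>
  have "q {} \<noteq> q UNIV"
    using c ba.bot_unique unfolding ba.tower_def by (metis ba.top_greatest)
  \<comment> \<open>The continuum hypothesis enters here: it bounds the size of the carrier, which
    is the continuum, by \<open>cardSuc natLeq\<close>.\<close>
  moreover have "|UNIV :: nat set set| \<le>o cardSuc natLeq"
  proof -
    have "|Pow (UNIV :: nat set)| =o ctwo ^c natLeq"
      unfolding ctwo_def cexp_def Field_card_of Field_natLeq by (rule card_of_Pow_Func)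
    then have "|UNIV :: nat set set| =o ctwo ^c natLeq" by simp
    then show ?thesis using CH ordIso_transitive ordIso_imp_ordLeq by blast
  qed
  ultimately have "cardSuc natLeq =o ba.u_num"
    by (rule ba.u_num_eq_cardSuc_natLeq[OF split])
  moreover have "ba.f_num =o natLeq" by (rule ba.f_num_eq_natLeq[OF split c])
  moreover have "ba.s_mm =o ba.f_num"
    using ba.s_mm_eq_natLeq[OF c] calculation(2) ordIso_symmetric ordIso_transitive by blast
  moreover have "natLeq <o cardSuc natLeq" by (simp add: cardSuc_greater natLeq_Card_order)
  ultimately show ?thesis
    using boolean_algebra ba.splittable_not_atom[OF split] by blast
qed

end
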